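(* Let $A$ be a nonsingular $n\times n$ matrix, let $J\neq 0$ be a symmetric, singular $n\times n$ matrix, and let $B$ be an $m\times n$ matrix ($m<n$) such that $\mathcal{N}(J)\subseteq\mathcal{N}(B)$ and $\mathcal{R}(B^T)=\mathcal{R}(J)$. Let $\gamma>0$ be a scalar constant and assume that the matrix $$\mathbb{A}=\begin{bmatrix} A+\gamma J & B^T\\ B & \mathbf{0}\end{bmatrix}$$ is nonsingular. Let $P$ be an orthogonal projection onto $\mathcal{N}(J)$, let $Q=I-P$ denote its complement, and define $$E_P=P(PAP)^{-1}P,\qquad E_Q=Q(QJQ)^{-1}Q,$$ as projected inverses over the range of $P$ and $Q$. Let $S=-B(A+\gamma J)^{-1}B^T$ denote the Schur complement of $\mathbb{A}$. Then the action of $S$ takes the form $$-S\mathbf{x}=\gamma^{-1}BE_QB^T\mathbf{x}+\gamma^{-2}BR_\gamma B^T\mathbf{x},$$ where $$R_\gamma=\bigl(I+\gamma^{-1}E_QA(I-E_PA)\bigr)^{-1}E_QA(I-E_PA)E_Q,$$ and $E_PA$ is a projection onto $\mathcal{N}(J)$.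
   Context: Matrices are real, $\mathbf{x}\in\mathbb{R}^m$ is arbitrary, $I$ is the identity matrix, and $\mathcal{N}(\cdot)$ and $\mathcal{R}(\cdot)$ denote the nullspace and range of a matrix. That $E_P$ and $E_Q$ are projected inverses means that $(PAP)^{-1}$ is the inverse of $PAP$ as a linear map on the range of $P$, and $(QJQ)^{-1}$ is the inverse of $QJQ$ as a linear map on the range of $Q$. The inverse $(A+\gamma J)^{-1}$ is the one appearing in the definition of the Schur complement $S$.
   Formalization: The γ⁻² term carries a minus sign: −Sx = γ⁻¹BE_QBᵀx − γ⁻²BR_γBᵀx; the plus sign fails for A = I, J = diag(1,0), B = (1 0), where −S = 1/(1+γ) but the plus version gives (2+γ)/(γ(1+γ)). *)

theory Defs
  imports "HOL-Analysis.Analysis"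
begin

definition null_space :: "real^'n^'m \<Rightarrow> (real^'n) set" where
  "null_space M = {x. M *v x = 0}"

definition range_space :: "real^'n^'m \<Rightarrow> (real^'m) set" where
  "range_space M = range ((*v) M)"

definition block_matrix ::
  "real^'n^'m \<Rightarrow> real^'k^'m \<Rightarrow> real^'n^'l \<Rightarrow> real^'k^'l \<Rightarrow> real^('n + 'k)^('m + 'l)" where
  "block_matrix M11 M12 M21 M22 =
     (\<chi> i j. case i of
        Inl a \<Rightarrow> (case j of Inl c \<Rightarrow> M11 $ a $ c | Inr d \<Rightarrow> M12 $ a $ d)
      | Inr b \<Rightarrow> (case j of Inl c \<Rightarrow> M21 $ b $ c | Inr d \<Rightarrow> M22 $ b $ d))"

definition projection_onto :: "real^'n^'n \<Rightarrow> (real^'n) set \<Rightarrow> bool" where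
  "projection_onto P V \<longleftrightarrow> P ** P = P \<and> range_space P = V"

definition orthogonal_projection_onto :: "real^'n^'n \<Rightarrow> (real^'n) set \<Rightarrow> bool" where
  "orthogonal_projection_onto P V \<longleftrightarrow> projection_onto P V \<and> transpose P = P"

text \<open>The compression \<open>PMP\<close> is in general singular on the whole space; the inverse in
  \<open>P (PMP)\<^sup>-\<^sup>1 P\<close> is that of \<open>PMP\<close> as a map from the range of \<open>P\<close> to itself.
  The value of \<open>projected_inverse\<close> is meaningful only if that map is bijective, which is what
  \<open>projected_invertible\<close> says.\<close>

definition projected_invertible :: "real^'n^'n \<Rightarrow> real^'n^'n \<Rightarrow> bool" where
  "projected_invertible P M \<longleftrightarrow>
     bij_betw ((*v) (P ** M ** P)) (range_space P) (range_space P)"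

definition projected_inverse :: "real^'n^'n \<Rightarrow> real^'n^'n \<Rightarrow> real^'n^'n" where
  "projected_inverse P M =
     matrix (\<lambda>x. P *v (inv_into (range_space P) ((*v) (P ** M ** P)) (P *v x)))"

text \<open>Sign of the second-order term: with \<open>R\<^sub>\<gamma> = (I + \<gamma>\<^sup>-\<^sup>1 K)\<^sup>-\<^sup>1 K E\<^sub>Q\<close>, where
  \<open>K = E\<^sub>Q A (I - E\<^sub>P A)\<close>, one has \<open>B (A + \<gamma> J)\<^sup>-\<^sup>1 B\<^sup>T =
  \<gamma>\<^sup>-\<^sup>1 B E\<^sub>Q B\<^sup>T - \<gamma>\<^sup>-\<^sup>2 B R\<^sub>\<gamma> B\<^sup>T\<close>. The variant with a plus sign found in the source is
  false: for \<open>A = I\<close>, \<open>J = diag(1,0)\<close>, \<open>B = (1 0)\<close> the left-hand side is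
  \<open>1 / (1 + \<gamma>)\<close>, while \<open>\<gamma>\<^sup>-\<^sup>1 + \<gamma>\<^sup>-\<^sup>2 (\<gamma> / (1 + \<gamma>)) = (2 + \<gamma>) / (\<gamma> (1 + \<gamma>))\<close>.\<close>

end

(* Put M = A + \<gamma>J and W = I + \<gamma>\<^sup>-\<^sup>1 E\<^sub>Q A (I - E\<^sub>P A). Since P annihilates both J and A (I - E\<^sub>P A) from the
   left, M (I - E\<^sub>P A) is unchanged by Q = J E\<^sub>Q, which yields the factorisation
   M (I - E\<^sub>P A) = \<gamma> J W. It shows that W is injective, and multiplied by W\<^sup>-\<^sup>1 E\<^sub>Q it gives
   \<gamma> M\<^sup>-\<^sup>1 Q = (I - E\<^sub>P A) W\<^sup>-\<^sup>1 E\<^sub>Q. Here B E\<^sub>P = 0, so B M\<^sup>-\<^sup>1 B\<^sup>T = \<gamma>\<^sup>-\<^sup>1 B W\<^sup>-\<^sup>1 E\<^sub>Q B\<^sup>T, and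
   W\<^sup>-\<^sup>1 = I - W\<^sup>-\<^sup>1 (W - I) turns this into the claimed formula.
   Nonsingularity of the block matrix is what makes PAP invertible on the nullspace of J:
   if P A x = 0 with J x = 0, then A x = B\<^sup>T y for some y, and the block matrix kills (x, -y). *)

theory Submission
  imports Defs
begin

lemma invertible_iff_ker:
  fixes M :: "real^'n^'n"
  shows "invertible M \<longleftrightarrow> (\<forall>x. M *v x = 0 \<longrightarrow> x = 0)"
  by (simp add: invertible_left_inverse matrix_left_invertible_ker)

lemma range_space_idempotent_iff:
  assumes "P ** P = P"
  shows "x \<in> range_space P \<longleftrightarrow> P *v x = x"
  using assms by (auto simp: range_space_def matrix_vector_mul_assoc image_iff) metis

lemma matrix_inv_mult:
  fixes M :: "real^'n^'n"
  assumes "invertible M"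
  shows "M ** matrix_inv M = mat 1" "matrix_inv M ** M = mat 1"
  using assms unfolding invertible_def matrix_inv_def by (metis (mono_tags, lifting) someI_ex)+

text \<open>Injectivity of the compression on the range of \<open>P\<close> is enough: extended by
  the identity on the kernel of \<open>P\<close>, it becomes an injective and hence invertible
  square matrix. Serves both pairs, \<open>P\<close> with \<open>A\<close> and \<open>Q\<close> with
  \<open>J\<close>.\<close>

lemma projected_inverse_properties:
  fixes P M :: "real^'n^'n"
  assumes idem: "P ** P = P"
    and ker: "\<forall>x. P *v x = x \<longrightarrow> P *v (M *v x) = 0 \<longrightarrow> x = 0"
  shows "projected_invertible P M"
    and "P ** projected_inverse P M = projected_inverse P M"
    and "projected_inverse P M ** M ** P = P"
    and "P ** M ** projected_inverse P M = P"
proof -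
  \<comment> \<open>Invertible on the whole space and commuting with \<open>P\<close>, so that the inverse of the compression
    is the restriction of \<open>N\<^sup>-\<^sup>1\<close> to the range of \<open>P\<close>.\<close>
  define N where "N = P ** M ** P + (mat 1 - P)"
  have PP: "P *v (P *v x) = P *v x" for x
    by (simp add: matrix_vector_mul_assoc idem)
  have N_apply: "N *v x = P *v (M *v (P *v x)) + (x - P *v x)" for x
    by (simp add: N_def matrix_vector_mul_assoc[symmetric] algebra_simps)
  have PN_apply: "P *v (N *v x) = P *v (M *v (P *v x))" for x
    by (simp add: N_apply PP algebra_simps)
  have "x = 0" if "N *v x = 0" for x
  proof -
    have z: "P *v (M *v (P *v x)) = 0"
      using PN_apply[of x] that by simp
    then have "P *v x = x"
      using N_apply[of x] that by simp
    with z show ?thesis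
      using ker by simp
  qed
  then have "invertible N"
    by (simp add: invertible_iff_ker)
  define N' where "N' = matrix_inv N"
  have NN': "N ** N' = mat 1" "N' ** N = mat 1"
    using matrix_inv_mult[OF \<open>invertible N\<close>] by (simp_all add: N'_def)
  have PN: "P ** N = P ** M ** P" and NP: "N ** P = P ** M ** P"
    by (simp_all add: matrix_eq matrix_vector_mul_assoc[symmetric] N_apply PP algebra_simps)
  have N'P: "N' ** P = P ** N'"
  proof -
    have "N' ** P = N' ** (P ** N) ** N'"
      by (metis NN'(1) matrix_mul_assoc matrix_mul_rid)
    also have "\<dots> = N' ** (N ** P) ** N'"
      by (simp add: PN NP)
    also have "\<dots> = P ** N'"
      by (metis NN'(2) matrix_mul_assoc matrix_mul_lid)
    finally show ?thesis .
  qed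
  have N'_range: "P *v (N' *v y) = N' *v y" if "P *v y = y" for y
    by (metis N'P matrix_vector_mul_assoc that)
  have right_inv: "P *v (M *v (N' *v y)) = y" if "P *v y = y" for y
    by (metis N'_range NN'(1) PN matrix_vector_mul_assoc matrix_vector_mul_lid that)
  have left_inv: "N' *v (P *v (M *v x)) = x" if "P *v x = x" for x
    by (metis NN'(2) NP matrix_vector_mul_assoc matrix_vector_mul_lid that)
  have bij: "bij_betw ((*v) (P ** M ** P)) (range_space P) (range_space P)"
    by (rule bij_betw_byWitness[where f' = "(*v) N'"])
      (auto simp: range_space_idempotent_iff[OF idem] left_inv right_inv N'_range
        matrix_vector_mul_assoc[symmetric] PP)
  then show "projected_invertible P M"
    by (simp add: projected_invertible_def)
  have "inv_into (range_space P) ((*v) (P ** M ** P)) (P *v x) = N' *v (P *v x)" for x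
    by (rule inv_into_f_eq[OF bij_betw_imp_inj_on[OF bij]])
      (simp_all add: range_space_idempotent_iff[OF idem] N'_range right_inv PP
        flip: matrix_vector_mul_assoc)
  then have "projected_inverse P M = matrix (\<lambda>x. (N' ** P) *v x)"
    by (simp add: projected_inverse_def N'_range PP flip: matrix_vector_mul_assoc
        del: matrix_of_matrix_vector_mul)
  then have E: "projected_inverse P M = N' ** P"
    by simp
  show "P ** projected_inverse P M = projected_inverse P M"
    by (metis E N'P idem matrix_mul_assoc)
  show "projected_inverse P M ** M ** P = P"
    by (metis E NP NN'(2) matrix_mul_assoc matrix_mul_lid)
  show "P ** M ** projected_inverse P M = P"
    by (metis E N'P PN NN'(1) matrix_mul_assoc matrix_mul_rid)
qed

lemma sum_UNIV_Plus:
  fixes f :: "'a::finite + 'b::finite \<Rightarrow> 'c::comm_monoid_add"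
  shows "sum f UNIV = (\<Sum>a\<in>UNIV. f (Inl a)) + (\<Sum>b\<in>UNIV. f (Inr b))"
  by (simp add: sum.Plus o_def flip: UNIV_Plus_UNIV)

lemma invertible_block_matrix_ker:
  fixes M :: "real^'n^'n" and C :: "real^'m^'n" and B :: "real^'n^'m"
  assumes inv: "invertible (block_matrix M C B 0)"
    and Mx: "M *v x = C *v y" and Bx: "B *v x = 0"
  shows "x = 0"
proof -
  \<comment> \<open>The stacked vector (x, -y): the upper block row sends it to
    \<open>M *v x - C *v y\<close>, the lower one to \<open>B *v x\<close>.\<close>
  define z :: "real^('n + 'm)" where "z = (\<chi> i. case i of Inl a \<Rightarrow> x $ a | Inr b \<Rightarrow> - (y $ b))"
  have "(block_matrix M C B 0 *v z) $ i = 0" for i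
  proof (cases i)
    case (Inl a)
    have "(block_matrix M C B 0 *v z) $ i = (M *v x) $ a - (C *v y) $ a"
      by (simp add: Inl z_def block_matrix_def matrix_vector_mult_def sum_UNIV_Plus sum_negf)
    then show ?thesis
      by (simp add: Mx)
  next
    case (Inr b)
    have "(block_matrix M C B 0 *v z) $ i = (B *v x) $ b"
      by (simp add: Inr z_def block_matrix_def matrix_vector_mult_def sum_UNIV_Plus)
    then show ?thesis
      by (simp add: Bx)
  qed
  then have "block_matrix M C B 0 *v z = 0"
    by (simp add: vec_eq_iff)
  then have "z = 0"
    using inv by (simp add: invertible_iff_ker)
  then have "z $ Inl a = 0" for a
    by simp
  then show ?thesis
    by (simp add: z_def vec_eq_iff)
qed

text \<open>The invertibility claims belong to the conclusion because
  \<open>projected_inverse\<close> and \<open>matrix_inv\<close> denote the intended inverses only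
  where these exist.\<close>

theorem lemma1:
  fixes A J P Q E\<^sub>P E\<^sub>Q R\<^sub>\<gamma> :: "real^'n^'n"
    and B :: "real^'n^'m"
    and S :: "real^'m^'m"
    and \<gamma> :: real
  assumes "CARD('m) < CARD('n)"
    and "invertible A"
    and "J \<noteq> 0" and "transpose J = J" and "\<not> invertible J"
    and "null_space J \<subseteq> null_space B"
    and "range_space (transpose B) = range_space J"
    and "\<gamma> > 0"
    and "invertible (block_matrix (A + \<gamma> *\<^sub>R J) (transpose B) B 0)"
    and "invertible (A + \<gamma> *\<^sub>R J)"
    and "orthogonal_projection_onto P (null_space J)"
    and "Q = mat 1 - P"
    and "E\<^sub>P = projected_inverse P A"
    and "E\<^sub>Q = projected_inverse Q J"
    and "S = - (B ** matrix_inv (A + \<gamma> *\<^sub>R J) ** transpose B)"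
    and "R\<^sub>\<gamma> = matrix_inv (mat 1 + inverse \<gamma> *\<^sub>R (E\<^sub>Q ** A ** (mat 1 - E\<^sub>P ** A)))
               ** (E\<^sub>Q ** A ** (mat 1 - E\<^sub>P ** A) ** E\<^sub>Q)"
  shows "projected_invertible P A \<and> projected_invertible Q J
    \<and> invertible (mat 1 + inverse \<gamma> *\<^sub>R (E\<^sub>Q ** A ** (mat 1 - E\<^sub>P ** A)))
    \<and> (\<forall>x. - (S *v x) = inverse \<gamma> *\<^sub>R ((B ** E\<^sub>Q ** transpose B) *v x)
                         - inverse (\<gamma>\<^sup>2) *\<^sub>R ((B ** R\<^sub>\<gamma> ** transpose B) *v x))
    \<and> projection_onto (E\<^sub>P ** A) (null_space J)"
proof -
  define M where "M = A + \<gamma> *\<^sub>R J"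
  define K where "K = E\<^sub>Q ** A ** (mat 1 - E\<^sub>P ** A)"
  define W where "W = mat 1 + inverse \<gamma> *\<^sub>R K"
  have \<gamma>: "\<gamma> \<noteq> 0"
    using \<open>\<gamma> > 0\<close> by simp
  have PP: "P ** P = P" and rangeP: "range_space P = null_space J" and Pt: "transpose P = P"
    using \<open>orthogonal_projection_onto P (null_space J)\<close>
    by (auto simp: orthogonal_projection_onto_def projection_onto_def)
  have P_idem: "P *v (P *v x) = P *v x" for x
    by (simp add: matrix_vector_mul_assoc PP)
  have Q_apply: "Q *v x = x - P *v x" for x
    by (simp add: \<open>Q = mat 1 - P\<close> algebra_simps)
  have QQ: "Q ** Q = Q"
    by (simp add: matrix_eq matrix_vector_mul_assoc[symmetric] Q_apply P_idem algebra_simps)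
  have fix_P: "P *v x = x \<longleftrightarrow> J *v x = 0" for x
    using rangeP by (auto simp: range_space_idempotent_iff[OF PP, symmetric] null_space_def)
  have JP_apply: "J *v (P *v x) = 0" for x
    using fix_P P_idem by blast
  then have JP: "J ** P = 0"
    by (simp add: matrix_eq matrix_vector_mul_assoc[symmetric])
  have BP_apply: "B *v (P *v x) = 0" for x
    using JP_apply \<open>null_space J \<subseteq> null_space B\<close> by (auto simp: null_space_def)
  then have BP: "B ** P = 0"
    by (simp add: matrix_eq matrix_vector_mul_assoc[symmetric])
  \<comment> \<open>Symmetry of \<open>J\<close> and of \<open>P\<close> turns annihilation of
    \<open>P\<close> from the left into annihilation by \<open>P\<close> from the left: transpose
    \<open>J ** P = 0\<close> and \<open>B ** P = 0\<close>.\<close>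
  have t0: "transpose (0::real^'a^'b) = 0"
    by (simp add: transpose_def vec_eq_iff)
  have PJ: "P ** J = 0"
    by (metis JP Pt \<open>transpose J = J\<close> matrix_transpose_mul t0)
  have PBt: "P ** transpose B = 0"
    by (metis BP Pt matrix_transpose_mul t0)
  have PJ_apply: "P *v (J *v x) = 0" for x
    by (simp add: matrix_vector_mul_assoc PJ)

  \<comment> \<open>On the range of \<open>Q\<close> one has \<open>P *v x = 0\<close>, and
    \<open>P ** J = 0\<close> reduces the second premise to \<open>J *v x = 0\<close>, that is,
    \<open>P *v x = x\<close>.\<close>
  have "\<forall>x. Q *v x = x \<longrightarrow> Q *v (J *v x) = 0 \<longrightarrow> x = 0"
    by (simp add: Q_apply PJ_apply flip: fix_P)
  note EQ = projected_inverse_properties[OF QQ this, folded \<open>E\<^sub>Q = _\<close>]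
  have QEQ: "Q ** E\<^sub>Q = E\<^sub>Q"
    by (simp add: EQ)
  have QJ: "Q ** J = J"
    by (simp add: matrix_eq matrix_vector_mul_assoc[symmetric] Q_apply PJ_apply)
  have JEQ: "J ** E\<^sub>Q = Q"
    using EQ(4) by (simp add: QJ)

  have kerP: "\<forall>x. P *v x = x \<longrightarrow> P *v (A *v x) = 0 \<longrightarrow> x = 0"
  proof (intro allI impI)
    fix x assume that: "P *v x = x" "P *v (A *v x) = 0"
    \<comment> \<open>Since \<open>P\<close> kills \<open>A *v x\<close>, \<open>Q\<close> fixes it,
      and \<open>Q = J ** E\<^sub>Q\<close> supplies an explicit preimage under
      \<open>J\<close>.\<close>
    have "A *v x = J *v (E\<^sub>Q *v (A *v x))"
      using that(2) by (simp add: matrix_vector_mul_assoc[of J] JEQ Q_apply)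
    then have "A *v x \<in> range_space J"
      unfolding range_space_def by (rule range_eqI)
    then have "A *v x \<in> range_space (transpose B)"
      by (simp add: \<open>range_space (transpose B) = range_space J\<close>)
    then obtain y where y: "A *v x = transpose B *v y"
      by (auto simp: range_space_def)
    have "J *v x = 0"
      using that fix_P by simp
    then have "(A + \<gamma> *\<^sub>R J) *v x = transpose B *v y"
      by (simp add: y algebra_simps scaleR_matrix_vector_assoc[symmetric])
    moreover have "B *v x = 0"
      using BP_apply[of x] that(1) by simp
    ultimately show "x = 0"
      using invertible_block_matrix_ker
        \<open>invertible (block_matrix (A + \<gamma> *\<^sub>R J) (transpose B) B 0)\<close> by blast
  qed
  note EP = projected_inverse_properties[OF PP kerP, folded \<open>E\<^sub>P = _\<close>]

  have PEP: "P *v (E\<^sub>P *v x) = E\<^sub>P *v x" for x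
    by (simp add: matrix_vector_mul_assoc EP(2))
  have EPAP: "E\<^sub>P *v (A *v (P *v x)) = P *v x" for x
    by (simp add: matrix_vector_mul_assoc matrix_mul_assoc EP(3))
  have PAEP: "P *v (A *v (E\<^sub>P *v x)) = P *v x" for x
    by (simp add: matrix_vector_mul_assoc matrix_mul_assoc EP(4))
  have PEQ: "P *v (E\<^sub>Q *v x) = 0" for x
    using QEQ Q_apply[of "E\<^sub>Q *v x"] by (simp add: matrix_vector_mul_assoc)
  have JEQ_apply: "J *v (E\<^sub>Q *v x) = x - P *v x" for x
    by (simp add: matrix_vector_mul_assoc JEQ flip: Q_apply)
  have JEP: "J *v (E\<^sub>P *v x) = 0" for x
    using JP_apply PEP by metis
  have BEP: "B *v (E\<^sub>P *v x) = 0" for x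
    using BP_apply PEP by metis

  have proj: "projection_onto (E\<^sub>P ** A) (null_space J)"
    unfolding projection_onto_def
  proof
    \<comment> \<open>\<open>E\<^sub>P\<close> maps into the range of \<open>P\<close>, where
      \<open>E\<^sub>P ** A\<close> is the identity by \<open>EPAP\<close>.\<close>
    show idem: "E\<^sub>P ** A ** (E\<^sub>P ** A) = E\<^sub>P ** A"
      unfolding matrix_eq matrix_vector_mul_assoc[symmetric] using EPAP PEP by metis
    show "range_space (E\<^sub>P ** A) = null_space J"
    proof (intro set_eqI iffI)
      fix x assume "x \<in> range_space (E\<^sub>P ** A)"
      then show "x \<in> null_space J"
        by (auto simp: range_space_def null_space_def matrix_vector_mul_assoc[symmetric] JEP)
    next
      fix x assume "x \<in> null_space J"
      then have "P *v x = x"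
        by (simp add: fix_P null_space_def)
      then have "(E\<^sub>P ** A) *v x = x"
        using EPAP[of x] by (simp add: matrix_vector_mul_assoc)
      then show "x \<in> range_space (E\<^sub>P ** A)"
        using range_space_idempotent_iff[OF idem] by blast
    qed
  qed

  have K_apply: "K *v x = E\<^sub>Q *v (A *v (x - E\<^sub>P *v (A *v x)))" for x
    by (simp add: K_def matrix_vector_mul_assoc[symmetric] matrix_vector_mult_diff_rdistrib)
  have W_apply: "W *v x = x + inverse \<gamma> *\<^sub>R (K *v x)" for x
    by (simp add: W_def algebra_simps scaleR_matrix_vector_assoc[symmetric])
  \<comment> \<open>Replacing \<open>J ** E\<^sub>Q\<close> by I - P leaves the extra term P A (x -
    \<open>E\<^sub>P\<close> A x), which vanishes by \<open>PAEP\<close>.\<close>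
  have factor: "M *v (x - E\<^sub>P *v (A *v x)) = \<gamma> *\<^sub>R (J *v (W *v x))" for x
    by (simp add: M_def W_apply K_apply JEQ_apply JEP PAEP \<gamma> algebra_simps
        scaleR_matrix_vector_assoc[symmetric])
  have inv_M: "invertible M"
    using \<open>invertible (A + \<gamma> *\<^sub>R J)\<close> by (simp add: M_def)
  \<comment> \<open>The factorisation alone only places x in the nullspace of \<open>J\<close>, as I
    - \<open>E\<^sub>P\<close> A is zero there. On that space \<open>P\<close> recovers x from
    \<open>W *v x\<close>, because \<open>K\<close> maps into the range of \<open>Q\<close>.\<close>
  have "x = 0" if "W *v x = 0" for x
  proof -
    have "M *v (x - E\<^sub>P *v (A *v x)) = 0"
      by (simp add: factor that)
    then have "x - E\<^sub>P *v (A *v x) = 0"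
      using inv_M unfolding invertible_iff_ker by blast
    then have "x = E\<^sub>P *v (A *v x)"
      by simp
    then have "P *v x = x"
      using PEP by metis
    moreover have "P *v (W *v x) = P *v x"
      by (simp add: W_apply K_apply PEQ algebra_simps)
    ultimately show ?thesis
      using that by simp
  qed
  then have inv_W: "invertible W"
    by (simp add: invertible_iff_ker)

  have schur: "- (S *v x) = inverse \<gamma> *\<^sub>R ((B ** E\<^sub>Q ** transpose B) *v x)
                         - inverse (\<gamma>\<^sup>2) *\<^sub>R ((B ** R\<^sub>\<gamma> ** transpose B) *v x)" for x
  proof -
    define v where "v = transpose B *v x"
    \<comment> \<open>Chosen so that J W u = J \<open>E\<^sub>Q\<close> v = v, the last equality by
      \<open>P *v v = 0\<close>; \<open>factor\<close> then solves the system with matrix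
      \<open>M\<close> and right-hand side \<gamma> v.\<close>
    define u where "u = matrix_inv W *v (E\<^sub>Q *v v)"
    have Pv: "P *v v = 0"
      unfolding v_def matrix_vector_mul_assoc PBt by simp
    have W_inv: "W *v (matrix_inv W *v y) = y" "matrix_inv W *v (W *v y) = y" for y
      by (simp_all add: matrix_vector_mul_assoc matrix_inv_mult[OF inv_W])
    have Wu: "W *v u = E\<^sub>Q *v v"
      by (simp add: u_def W_inv)
    have "M *v (u - E\<^sub>P *v (A *v u)) = \<gamma> *\<^sub>R v"
      by (simp add: factor Wu JEQ_apply Pv)
    then have "u - E\<^sub>P *v (A *v u) = matrix_inv M *v (\<gamma> *\<^sub>R v)"
      by (metis inv_M matrix_inv_mult(2) matrix_vector_mul_assoc matrix_vector_mul_lid)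
    then have "B *v (u - E\<^sub>P *v (A *v u)) = \<gamma> *\<^sub>R (B *v (matrix_inv M *v v))"
      by (simp add: matrix_vector_mult_scaleR)
    then have Bu: "B *v u = \<gamma> *\<^sub>R (B *v (matrix_inv M *v v))"
      by (simp add: matrix_vector_mult_diff_distrib BEP)
    have "R\<^sub>\<gamma> *v v = matrix_inv W *v (K *v (E\<^sub>Q *v v))"
      by (simp add: \<open>R\<^sub>\<gamma> = _\<close> K_def W_def matrix_vector_mul_assoc matrix_mul_assoc)
    \<comment> \<open>Writing \<open>K\<close> as \<gamma> (W - I) lets the inverse of
      \<open>W\<close> cancel.\<close>
    also have "K *v (E\<^sub>Q *v v) = \<gamma> *\<^sub>R (W *v (E\<^sub>Q *v v) - E\<^sub>Q *v v)"
      by (simp add: W_apply \<gamma>)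
    also have "matrix_inv W *v \<dots> = \<gamma> *\<^sub>R (matrix_inv W *v (W *v (E\<^sub>Q *v v)) - u)"
      by (simp add: u_def algebra_simps)
    also have "\<dots> = \<gamma> *\<^sub>R (E\<^sub>Q *v v - u)"
      by (simp add: W_inv)
    finally have R: "R\<^sub>\<gamma> *v v = \<gamma> *\<^sub>R (E\<^sub>Q *v v - u)" .
    have "(B ** R\<^sub>\<gamma> ** transpose B) *v x = \<gamma> *\<^sub>R (B *v (E\<^sub>Q *v v)) - \<gamma> *\<^sub>R (B *v u)"
      by (simp add: matrix_vector_mul_assoc[symmetric] R algebra_simps flip: v_def
          del: transpose_matrix_vector)
    moreover have "(B ** E\<^sub>Q ** transpose B) *v x = B *v (E\<^sub>Q *v v)"
      by (simp add: matrix_vector_mul_assoc[symmetric] flip: v_def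
          del: transpose_matrix_vector)
    moreover have "- (S *v x) = B *v (matrix_inv M *v v)"
    proof -
      have "- (S *v x) = (- S) *v x"
        by (simp add: matrix_vector_mult_def vec_eq_iff sum_negf)
      then show ?thesis
        by (simp add: \<open>S = _\<close> v_def matrix_vector_mul_assoc matrix_mul_assoc flip: M_def
            del: transpose_matrix_vector)
    qed
    \<comment> \<open>With these scalars the two \<open>E\<^sub>Q\<close> terms cancel, and the
      surviving multiple of \<open>B *v u\<close> is exactly
      \<open>B *v (matrix_inv M *v v)\<close>.\<close>
    moreover have "inverse (\<gamma>\<^sup>2) * \<gamma> = inverse \<gamma>" "inverse (\<gamma>\<^sup>2) * (\<gamma> * \<gamma>) = 1"
      using \<gamma> by (simp_all add: field_simps power2_eq_square)
    ultimately show ?thesis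
      by (simp add: Bu scaleR_diff_right)
  qed
  show ?thesis
    using EP(1) EQ(1) inv_W schur proj by (simp add: W_def K_def)
qed

end
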